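(* Any non-degenerate completely well-centered simplex $T$ in $\mathbb{R}^d$ is an admissible domain for itself.
   Context: A simplex $T\subset\mathbb{R}^d$ with vertices ${\bf v}_0,\ldots,{\bf v}_d$ is non-degenerate if it is not contained in any $(d-1)$-dimensional hyperplane. The circumcenter of a simplex is the point of its affine span equidistant from all its vertices. $T$ is completely well-centered if $T$ and every face of $T$ (of any dimension) contain their circumcenters. Let ${\bf c}$ be the circumcenter of $T$, $\Sigma=\{0,1,\ldots,d\}$, ${\bf u}_i=\frac12({\bf c}+{\bf v}_i)$ for $i\in\Sigma$, and $U=\frac12({\bf c}+T)$, the simplex with vertices ${\bf u}_0,\ldots,{\bf u}_d$. For ${\bf x}\in U$, $b_0({\bf x}),\ldots,b_d({\bf x})$ are the barycentric coordinates of ${\bf x}$ relative to $U$. For non-empty $I\subset\Sigma$, $G_I:=\{{\bf x}\in U: b_i({\bf x})>0 \text{ for } i\in I,\ b_i({\bf x})=0 \text{ for } i\notin I\}$ (these sets partition $U$). The mapping $\varphi:\mathbb{R}^d\to U$ sends ${\bf x}$ to the unique point of $U$ closest to ${\bf x}$ in the Euclidean norm. A set $P\subset\mathbb{R}^d$ is an admissible domain for $T$ if $P$ is a convex set that contains $T$ and, for every ${\bf x}\in P$, we have ${\bf x}-\varphi({\bf x})+{\bf u}_i\in P$ for all $i\in I$, where $I\subset\Sigma$ is the subset such that $\varphi({\bf x})\in G_I$. *)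

theory Defs
  imports "HOL-Analysis.Analysis"
begin

text \<open>The space \<open>\<real>\<^sup>d\<close> is a Euclidean space \<open>'a\<close> with \<open>d = DIM('a)\<close>. The ordered vertices
  \<open>v\<^sub>0, \<dots>, v\<^sub>d\<close> are given by a function on \<open>nat\<close>; only its values on \<open>index_set = {0..d}\<close> matter.\<close>

abbreviation index_set :: "'a::euclidean_space itself \<Rightarrow> nat set" where
  "index_set _ \<equiv> {0..DIM('a)}"

definition simplex_of :: "(nat \<Rightarrow> 'a::euclidean_space) \<Rightarrow> 'a set" where
  "simplex_of v = convex hull (v ` index_set TYPE('a))"

definition nondegenerate :: "'a::euclidean_space set \<Rightarrow> bool" where
  "nondegenerate T \<longleftrightarrow>
     \<not> (\<exists>H. affine H \<and> aff_dim H = int DIM('a) - 1 \<and> T \<subseteq> H)"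

text \<open>The vertices of a simplex \<open>F\<close>, given as a set, are its extreme points. The circumcenter
  exists and is unique whenever the vertices are affinely independent, in particular for every
  nonempty face of a nondegenerate simplex.\<close>

definition circumcenter :: "'a::euclidean_space set \<Rightarrow> 'a" where
  "circumcenter F = (THE c. c \<in> affine hull F \<and>
     (\<exists>r. \<forall>w. w extreme_point_of F \<longrightarrow> dist c w = r))"

text \<open>A set is a face of itself, so the simplex is included below. The library also counts the
  empty set as a face; it has no circumcenter and is excluded.\<close>

definition completely_well_centered :: "'a::euclidean_space set \<Rightarrow> bool" where
  "completely_well_centered T \<longleftrightarrow>
     (\<forall>F. F face_of T \<and> F \<noteq> {} \<longrightarrow> circumcenter F \<in> F)"

definition half_vertex :: "(nat \<Rightarrow> 'a::euclidean_space) \<Rightarrow> nat \<Rightarrow> 'a" where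
  "half_vertex v i = (1/2) *\<^sub>R (circumcenter (simplex_of v) + v i)"

definition half_simplex :: "(nat \<Rightarrow> 'a::euclidean_space) \<Rightarrow> 'a set" where
  "half_simplex v = (\<lambda>y. (1/2) *\<^sub>R (circumcenter (simplex_of v) + y)) ` simplex_of v"

text \<open>Barycentric coordinates with respect to \<open>u\<^sub>0, \<dots>, u\<^sub>d\<close>; the condition outside \<open>index_set\<close>
  only serves to make the coordinate function unique.\<close>

definition barycentric :: "(nat \<Rightarrow> 'a::euclidean_space) \<Rightarrow> 'a \<Rightarrow> nat \<Rightarrow> real" where
  "barycentric u x = (THE b. (\<forall>i. i \<notin> index_set TYPE('a) \<longrightarrow> b i = 0) \<and>
     (\<Sum>i\<in>index_set TYPE('a). b i) = 1 \<and>
     (\<Sum>i\<in>index_set TYPE('a). b i *\<^sub>R u i) = x)"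

definition open_face :: "(nat \<Rightarrow> 'a::euclidean_space) \<Rightarrow> nat set \<Rightarrow> 'a set" where
  "open_face v I = {x \<in> half_simplex v.
     (\<forall>i\<in>I. barycentric (half_vertex v) x i > 0) \<and>
     (\<forall>i\<in>index_set TYPE('a) - I. barycentric (half_vertex v) x i = 0)}"

text \<open>The nearest-point map \<open>\<phi>\<close> onto \<open>U\<close> is \<open>closest_point (half_simplex v)\<close>. For nondegenerate
  simplices the sets \<open>open_face v I\<close> with nonempty \<open>I\<close> partition \<open>half_simplex v\<close>, so
  exactly one \<open>I\<close> satisfies the conditions below for each \<open>x\<close>.\<close>

definition admissible_domain :: "(nat \<Rightarrow> 'a::euclidean_space) \<Rightarrow> 'a set \<Rightarrow> bool" where
  "admissible_domain v P \<longleftrightarrow> convex P \<and> simplex_of v \<subseteq> P \<and>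
     (\<forall>x\<in>P. \<forall>I. I \<noteq> {} \<and> I \<subseteq> index_set TYPE('a) \<and>
        closest_point (half_simplex v) x \<in> open_face v I \<longrightarrow>
        (\<forall>i\<in>I. x - closest_point (half_simplex v) x + half_vertex v i \<in> P))"

end

theory Submission imports Defs begin

text \<open>Take the circumcenter \<open>c\<close> as origin, let \<open>p = \<phi> x\<close> lie in \<open>G\<^sub>I\<close>, and write \<open>l\<close>, \<open>b\<close> for the
  barycentric coordinates of \<open>x\<close> in \<open>T\<close> and of \<open>p\<close> in \<open>U\<close>. All conclusions follow once
  \<open>2 l\<^sub>k - b\<^sub>k \<ge> 0\<close>. These numbers are the barycentric coordinates in \<open>T\<close> of \<open>n = 2 (x - p)\<close>, which lies
  in the normal cone of the face \<open>I\<close>, and they are nonnegative outside \<open>I\<close>. To show that such an \<open>n\<close>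
  lies in \<open>T\<close>, move along the line through \<open>c\<close> and \<open>n\<close> to a point \<open>z\<close> in the affine span of a facet
  and use induction on the dimension to get \<open>z \<in> T\<close>. If \<open>z\<close> were strictly between \<open>c\<close> and \<open>n\<close>, then the
  vertex opposite to the facet would be among the vertices nearest to \<open>z\<close>; but in a completely
  well-centered simplex each point of a face has a nearest vertex in that face, and following the
  case of equality excludes this.\<close>

section \<open>Faces and their circumcenters in barycentric coordinates\<close>

text \<open>\<open>g K\<close> holds the barycentric coordinates of the circumcenter of the face \<open>K\<close>. With the origin at
  the circumcenter of the simplex all \<open>w i\<close> have equal norm, so being equidistant from the vertices of
  \<open>K\<close> means having the same inner product with them.\<close>

locale well_centered_points =
  fixes A :: "'i set" and w :: "'i \<Rightarrow> 'b::real_inner" and g :: "'i set \<Rightarrow> 'i \<Rightarrow> real"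
  assumes finite_A: "finite A"
    and independent: "\<And>c. sum c A = 0 \<Longrightarrow> (\<Sum>i\<in>A. c i *\<^sub>R w i) = 0 \<Longrightarrow> i \<in> A \<Longrightarrow> c i = 0"
    and g_nonneg: "\<And>K i. K \<subseteq> A \<Longrightarrow> K \<noteq> {} \<Longrightarrow> g K i \<ge> 0"
    and g_outside: "\<And>K i. K \<subseteq> A \<Longrightarrow> K \<noteq> {} \<Longrightarrow> i \<notin> K \<Longrightarrow> g K i = 0"
    and sum_g: "\<And>K. K \<subseteq> A \<Longrightarrow> K \<noteq> {} \<Longrightarrow> sum (g K) A = 1"
    and equidistant: "\<And>K i j. K \<subseteq> A \<Longrightarrow> i \<in> K \<Longrightarrow> j \<in> K \<Longrightarrow>
      (\<Sum>l\<in>A. g K l *\<^sub>R w l) \<bullet> w i = (\<Sum>l\<in>A. g K l *\<^sub>R w l) \<bullet> w j"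
begin

definition pt :: "('i \<Rightarrow> real) \<Rightarrow> 'b" where
  "pt c = (\<Sum>l\<in>A. c l *\<^sub>R w l)"

abbreviation center :: "'i set \<Rightarrow> 'b" where
  "center K \<equiv> pt (g K)"

lemma inner_pt: "x \<bullet> pt c = (\<Sum>l\<in>A. c l * (x \<bullet> w l))"
  by (simp add: pt_def inner_sum_right)

lemma inner_pt_const:
  assumes "\<And>l. l \<in> A \<Longrightarrow> c l \<noteq> 0 \<Longrightarrow> x \<bullet> w l = r"
  shows "x \<bullet> pt c = sum c A * r"
proof -
  have "x \<bullet> pt c = (\<Sum>l\<in>A. c l * r)"
    unfolding inner_pt using assms by (intro sum.cong) auto
  then show ?thesis by (simp add: sum_distrib_right)
qed

lemma pt_diff: "pt (\<lambda>i. c i - d i) = pt c - pt d"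
  by (simp add: pt_def scaleR_left_diff_distrib sum_subtractf)

lemma pt_scale: "pt (\<lambda>i. r * c i) = r *\<^sub>R pt c"
  by (simp add: pt_def scaleR_sum_right)

lemma pt_inject:
  assumes "pt c = pt d" "sum c A = sum d A" "i \<in> A"
  shows "c i = d i"
proof -
  have "c i - d i = 0"
    using assms pt_diff[of c d] unfolding pt_def
    by (intro independent[of "\<lambda>i. c i - d i"]) (auto simp: sum_subtractf)
  then show ?thesis by simp
qed

lemma center_inner:
  assumes "K \<subseteq> A" "k \<in> K"
  shows "center K \<bullet> w k = center K \<bullet> center K"
proof -
  have ne: "K \<noteq> {}" using assms by auto
  have "center K \<bullet> center K = sum (g K) A * (center K \<bullet> w k)"
  proof (rule inner_pt_const)
    fix l assume "g K l \<noteq> 0"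
    then have "l \<in> K" using g_outside[OF assms(1) ne, of l] by auto
    then show "center K \<bullet> w l = center K \<bullet> w k"
      unfolding pt_def by (rule equidistant[OF assms(1) _ assms(2)])
  qed
  then show ?thesis using sum_g[OF assms(1) ne] by simp
qed

text \<open>\<open>center N\<close> is the foot of the perpendicular from the origin to the affine
  span of the face \<open>N\<close>, so its inner product is constant on that span, which contains
  \<open>center L\<close>.\<close>

lemma center_inner_center:
  assumes "L \<subseteq> N" "N \<subseteq> A" "L \<noteq> {}"
  shows "center N \<bullet> center L = center N \<bullet> center N"
proof -
  have LA: "L \<subseteq> A" using assms by auto
  have "center N \<bullet> center L = sum (g L) A * (center N \<bullet> center N)"
  proof (rule inner_pt_const)
    fix l assume "g L l \<noteq> 0"
    then have "l \<in> N" using g_outside[OF LA assms(3), of l] assms(1) by auto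
    then show "center N \<bullet> w l = center N \<bullet> center N" by (rule center_inner[OF assms(2)])
  qed
  then show ?thesis unfolding sum_g[OF LA assms(3)] by (simp only: mult_1)
qed

section \<open>Nearest vertices\<close>

text \<open>Add the single vertex \<open>m\<close> to \<open>L\<close> and expand
  \<open>center L \<bullet> center N\<close> in the coordinates of \<open>center N\<close>: the
  excess at \<open>m\<close>, weighted by \<open>g N m \<ge> 0\<close>, equals minus the squared
  distance of the two centers.\<close>

lemma center_inner_max:
  assumes L: "L \<subseteq> A" and k: "k \<in> L" and m: "m \<in> A"
  shows "center L \<bullet> w m \<le> center L \<bullet> w k"
proof (cases "m \<in> L")
  case True
  then show ?thesis using center_inner[OF L] k by simp
next
  case False
  define N where "N = insert m L"
  have N: "N \<subseteq> A" "N \<noteq> {}" "L \<subseteq> N" "m \<in> N" using L m by (auto simp: N_def)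
  have ne: "L \<noteq> {}" using k by auto
  let ?r = "center L \<bullet> center L" and ?p = "center N \<bullet> center N"
  have LN: "center N \<bullet> center L = ?p" by (rule center_inner_center[OF N(3,1) ne])
  have sq: "(center L - center N) \<bullet> (center L - center N) = ?r - ?p"
    using LN by (simp add: inner_diff_left inner_diff_right inner_commute)
  have "center L \<bullet> center N = (\<Sum>l\<in>A. g N l * (center L \<bullet> w l))" by (rule inner_pt)
  also have "\<dots> = (\<Sum>l\<in>A. g N l * ?r + (if l = m then g N m * (center L \<bullet> w m - ?r) else 0))"
  proof (intro sum.cong refl)
    fix l assume "l \<in> A"
    show "g N l * (center L \<bullet> w l) = g N l * ?r + (if l = m then g N m * (center L \<bullet> w m - ?r) else 0)"
      using center_inner[OF L, of l] g_outside[OF N(1,2), of l]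
      by (cases "l = m"; cases "l \<in> L") (auto simp: N_def algebra_simps)
  qed
  also have "\<dots> = ?r + g N m * (center L \<bullet> w m - ?r)"
    using m finite_A sum_g[OF N(1,2)] by (simp add: sum.distrib flip: sum_distrib_right)
  finally have eq: "g N m * (center L \<bullet> w m - ?r) = ?p - ?r"
    using LN by (simp add: inner_commute)
  have le: "?p - ?r \<le> 0" using sq inner_ge_zero[of "center L - center N"] by linarith
  have "center L \<bullet> w m \<le> ?r"
  proof (cases "g N m = 0")
    case True
    \<comment> \<open>With weight zero at \<open>m\<close> the squared distance vanishes, so
      equality holds.\<close>
    then have "center L = center N" using eq sq by simp
    then show ?thesis using center_inner[OF N(1,4)] by simp
  next
    case False
    then have "g N m > 0" using g_nonneg[OF N(1,2), of m] by linarith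
    then show ?thesis using eq le by (smt (verit) mult_pos_pos)
  qed
  then show ?thesis using center_inner[OF L k] by simp
qed

text \<open>Ratio test: the minimal ratio is the multiple of \<open>g K\<close> whose subtraction
  from \<open>c\<close> first produces a zero, at \<open>k\<close>, on the support of
  \<open>g K\<close>.\<close>

lemma exists_min_ratio:
  assumes "K \<subseteq> A" "K \<noteq> {}"
  obtains k where "k \<in> K" "g K k > 0"
    "\<And>l. l \<in> A \<Longrightarrow> g K l > 0 \<Longrightarrow> c k / g K k * g K l \<le> c l"
proof -
  let ?S = "{l \<in> A. g K l > 0}"
  have "?S \<noteq> {}"
  proof
    assume "?S = {}"
    then have "sum (g K) A = 0"
      using g_nonneg[OF assms] by (intro sum.neutral) (force simp: less_le)
    then show False using sum_g[OF assms] by simp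
  qed
  moreover have "finite ?S" using finite_A by simp
  ultimately have "Min ((\<lambda>l. c l / g K l) ` ?S) \<in> (\<lambda>l. c l / g K l) ` ?S"
    by (intro Min_in) auto
  then obtain k where k: "k \<in> ?S" "Min ((\<lambda>l. c l / g K l) ` ?S) = c k / g K k" by auto
  have "c k / g K k \<le> c l / g K l" if "l \<in> ?S" for l
    unfolding k(2)[symmetric] using \<open>finite ?S\<close> that by (intro Min_le) auto
  then have "c k / g K k * g K l \<le> c l" if "l \<in> A" "g K l > 0" for l
    using that by (simp add: pos_le_divide_eq)
  moreover have "k \<in> K" using k g_outside[OF assms, of k] by force
  ultimately show thesis using that k by blast
qed

text \<open>Radial projection from \<open>center L\<close> moves the point to a proper face, where induction
  supplies a nearest vertex; that vertex stays nearest when the center is mixed back in.\<close>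

lemma nearest_vertex_in_support:
  assumes "\<And>i. i \<in> A \<Longrightarrow> c i \<ge> 0" "sum c A = 1" "L = {i \<in> A. c i > 0}"
  shows "\<exists>k\<in>L. \<exists>e>0. \<forall>m\<in>A. e * (center L \<bullet> w k - center L \<bullet> w m) \<le> pt c \<bullet> w k - pt c \<bullet> w m"
  using assms
proof (induction "card L" arbitrary: L c rule: less_induct)
  case less
  have L: "L \<subseteq> A" "finite L" using less.prems finite_A by auto
  have "L \<noteq> {}"
  proof
    assume "L = {}"
    then have "sum c A = 0" using less.prems(1,3) by (intro sum.neutral) force
    then show False using less.prems(2) by simp
  qed
  note ne = this
  obtain k0 where k0: "k0 \<in> L" "g L k0 > 0"
    and min: "\<And>l. l \<in> A \<Longrightarrow> g L l > 0 \<Longrightarrow> c k0 / g L k0 * g L l \<le> c l"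
    using exists_min_ratio[OF L(1) ne] by metis
  \<comment> \<open>The largest multiple of \<open>g L\<close> that can be subtracted from
    \<open>c\<close> while keeping all coordinates nonnegative.\<close>
  define e where "e = c k0 / g L k0"
  have e: "e > 0" using k0 less.prems by (auto simp: e_def)
  have le: "e * g L l \<le> c l" if "l \<in> A" for l
    using min[OF that] g_nonneg[OF L(1) ne, of l] less.prems(1)[OF that]
    by (cases "g L l = 0") (auto simp: e_def)
  have "sum (\<lambda>l. e * g L l) A \<le> sum c A" using le by (intro sum_mono) auto
  then have e1: "e \<le> 1" using sum_g[OF L(1) ne] less.prems(2) by (simp flip: sum_distrib_left)
  show ?case
  proof (cases "e = 1")
    case True
    have "(\<Sum>l\<in>A. c l - g L l) = 0" using sum_g[OF L(1) ne] less.prems(2) by (simp add: sum_subtractf)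
    then have "\<forall>l\<in>A. c l - g L l = 0"
      using le True finite_A by (subst (asm) sum_nonneg_eq_0_iff) auto
    then have "pt c = center L" by (auto simp: pt_def intro!: sum.cong)
    then show ?thesis using k0 by (intro bexI[of _ k0] exI[of _ 1]) auto
  next
    case False
    then have e1: "e < 1" using e1 by simp
    \<comment> \<open>The radial projection of \<open>pt c\<close> from \<open>center L\<close>,
      normalized to total weight 1; its coordinate at \<open>k0\<close> vanishes.\<close>
    define d where "d i = (1 / (1 - e)) * (c i - e * g L i)" for i
    define L' where "L' = {i \<in> A. d i > 0}"
    have d0: "d i \<ge> 0" if "i \<in> A" for i using le[OF that] e1 by (simp add: d_def)
    have dsum: "sum d A = 1"
      using sum_g[OF L(1) ne] less.prems(2) e1
      by (simp add: d_def sum_subtractf flip: sum_distrib_left sum_divide_distrib)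
    have "d k0 = 0" using k0 by (simp add: d_def e_def)
    moreover have "L' \<subseteq> L"
      using less.prems(1,3) g_outside[OF L(1) ne] d_def by (fastforce simp: L'_def)
    ultimately have sub: "L' \<subset> L" using k0 L'_def by auto
    then have "card L' < card L" using L(2) by (rule psubset_card_mono[rotated])
    from less.hyps[OF this d0 dsum L'_def] obtain k e' where k: "k \<in> L'" and e': "e' > 0"
      and IH: "\<And>m. m \<in> A \<Longrightarrow> e' * (center L' \<bullet> w k - center L' \<bullet> w m) \<le> pt d \<bullet> w k - pt d \<bullet> w m"
      by blast
    have L'A: "L' \<subseteq> A" by (auto simp: L'_def)
    have "pt d = (1 / (1 - e)) *\<^sub>R (pt c - e *\<^sub>R center L)"
      unfolding d_def pt_scale pt_diff ..
    then have ptc: "pt c = (1 - e) *\<^sub>R pt d + e *\<^sub>R center L" using e1 by simp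
    \<comment> \<open>The share of \<open>pt d\<close> contributes a nonnegative amount, and the
      share \<open>e\<close> of \<open>center L\<close> supplies the margin, which later resolves
      ties between nearest vertices.\<close>
    have "e * (center L \<bullet> w k - center L \<bullet> w m) \<le> pt c \<bullet> w k - pt c \<bullet> w m" if m: "m \<in> A" for m
    proof -
      have "0 \<le> e' * (center L' \<bullet> w k - center L' \<bullet> w m)"
        using center_inner_max[OF L'A k m] e' by simp
      then have "0 \<le> (1 - e) * (pt d \<bullet> w k - pt d \<bullet> w m)" using IH[OF m] e1 by simp
      then show ?thesis unfolding ptc by (simp add: inner_add_left algebra_simps)
    qed
    then show ?thesis using e k sub by blast
  qed
qed

section \<open>Points in the normal cone of a face\<close>

text \<open>The hypotheses with \<open>h\<close> say that \<open>pt c - center F\<close> is an outward normal of the face \<open>I\<close> of \<open>F\<close>;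
  they survive the passage to a facet of \<open>F\<close> along the line through \<open>center F\<close>.\<close>

lemma normal_cone_coordinates_nonneg:
  assumes "F \<subseteq> A" "I \<subseteq> F" "I \<noteq> {}"
    and "\<And>i. i \<in> A - F \<Longrightarrow> c i = 0" "sum c A = 1"
    and "\<And>k. k \<in> F \<Longrightarrow> pt c \<bullet> w k \<le> h" "\<And>i. i \<in> I \<Longrightarrow> pt c \<bullet> w i = h"
    and "\<And>m. m \<in> F - I \<Longrightarrow> c m \<ge> 0"
    and "i \<in> A"
  shows "c i \<ge> 0"
  using assms
proof (induction "card F" arbitrary: F I c h i rule: less_induct)
  case less
  note F = less.prems(1) and IF = less.prems(2) and out = less.prems(4) and csum = less.prems(5)
    and leh = less.prems(6) and eqh = less.prems(7) and cpos = less.prems(8)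
  have ne: "F \<noteq> {}" using less.prems by auto
  have finF: "finite F" using F finite_A finite_subset by blast
  note g0 = g_nonneg[OF F ne] and gout = g_outside[OF F ne] and gsum = sum_g[OF F ne]
  obtain k0 where k0: "k0 \<in> F" "g F k0 > 0"
    and min: "\<And>l. l \<in> A \<Longrightarrow> g F l > 0 \<Longrightarrow> c k0 / g F k0 * g F l \<le> c l"
    using exists_min_ratio[OF F ne] by metis
  define a where "a = c k0 / g F k0"
  note min = min[folded a_def]
  have le: "a * g F l \<le> c l" if "l \<in> A" "l \<notin> I" for l
    using min[OF that(1)] g0[of l] out[of l] cpos[of l] that
    by (cases "g F l = 0"; cases "l \<in> F") auto
  show ?case
  proof (cases "a \<ge> 1")
    case True
    \<comment> \<open>Off \<open>I\<close> the coefficients \<open>c l - g F l\<close> are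
      nonnegative, and on \<open>I\<close> the product with \<open>pt c\<close> is exactly
      \<open>h\<close>. Replacing every product by the same constant thus bounds the squared norm by
      a multiple of the coefficient sum, which is 0.\<close>
    let ?d = "pt c - center F"
    have "?d \<bullet> ?d = ?d \<bullet> pt (\<lambda>l. c l - g F l)" by (simp add: pt_diff)
    also have "\<dots> = (\<Sum>l\<in>A. (c l - g F l) * (?d \<bullet> w l))" by (rule inner_pt)
    also have "\<dots> \<le> (\<Sum>l\<in>A. (c l - g F l) * (h - center F \<bullet> center F))"
    proof (intro sum_mono)
      fix l assume l: "l \<in> A"
      show "(c l - g F l) * (?d \<bullet> w l) \<le> (c l - g F l) * (h - center F \<bullet> center F)"
      proof (cases "l \<in> F")
        case False
        then show ?thesis using out gout l by simp
      next
        case lF: True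
        then have *: "?d \<bullet> w l = pt c \<bullet> w l - center F \<bullet> center F"
          using center_inner[OF F] by (simp add: inner_diff_left)
        show ?thesis
        proof (cases "l \<in> I")
          case True
          then show ?thesis using eqh * by simp
        next
          case False
          have "1 * g F l \<le> a * g F l" using True g0 by (intro mult_right_mono) auto
          then have "g F l \<le> c l" using le[OF l False] by simp
          then show ?thesis using leh[OF lF] * by (intro mult_left_mono) auto
        qed
      qed
    qed
    also have "\<dots> = 0" using csum gsum by (simp add: sum_subtractf flip: sum_distrib_right)
    finally have "pt c = center F" using inner_ge_zero[of ?d] by (metis antisym inner_eq_zero_iff right_minus_eq)
    then show ?thesis using pt_inject[of c "g F" i] csum gsum g0 less.prems(9) by simp
  next
    case False
    then have a1: "a < 1" by simp
    \<comment> \<open>The point where the line through \<open>center F\<close> and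
      \<open>pt c\<close> meets the affine span of the facet opposite to \<open>k0\<close>.\<close>
    define d where "d l = (1 / (1 - a)) * (c l - a * g F l)" for l
    have ptd: "pt d = (1 / (1 - a)) *\<^sub>R (pt c - a *\<^sub>R center F)"
      unfolding d_def pt_scale pt_diff ..
    have dk0: "d k0 = 0" using k0 by (simp add: d_def a_def)
    have dsum: "sum d A = 1"
      using gsum csum a1 by (simp add: d_def sum_subtractf flip: sum_distrib_left sum_divide_distrib)
    define h' where "h' = (1 / (1 - a)) * (h - a * (center F \<bullet> center F))"
    have inn: "pt d \<bullet> w k = (1 / (1 - a)) * (pt c \<bullet> w k - a * (center F \<bullet> center F))" if "k \<in> F" for k
      unfolding ptd using center_inner[OF F that] by (simp add: inner_diff_left)
    have leh': "pt d \<bullet> w k \<le> h'" if "k \<in> F" for k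
      unfolding inn[OF that] h'_def using leh[OF that] a1 by (intro mult_left_mono) auto
    have eqh': "pt d \<bullet> w k = h'" if "k \<in> I" for k
      using inn[of k] eqh[OF that] IF that by (auto simp: h'_def)
    have dout: "d l = 0" if "l \<in> A - (F - {k0})" for l
      using that dk0 out[of l] gout[of l] by (cases "l = k0") (auto simp: d_def)
    have dpos: "d m \<ge> 0" if "m \<in> A" "m \<notin> I" for m
      using le[OF that] a1 by (simp add: d_def)
    have d0: "d l \<ge> 0" if l: "l \<in> A" for l
    \<comment> \<open>The induction hypothesis requires a nonempty face; if only \<open>k0\<close>
      could be in \<open>I\<close>, all other coordinates are already nonnegative.\<close>
    proof (cases "I - {k0} = {}")
      case True
      then show ?thesis using dpos[OF l] dk0 by (cases "l = k0") auto
    next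
      case nonempty: False
      have card: "card (F - {k0}) < card F" using finF k0(1) by (rule card_Diff1_less)
      show ?thesis
        by (rule less.hyps[OF card, of "I - {k0}" d h' l])
          (use F IF nonempty dout dsum leh' eqh' dpos l in auto)
    qed
    have cd: "c l = (1 - a) * d l + a * g F l" for l using a1 by (simp add: d_def)
    have "a \<ge> 0"
    proof (rule ccontr)
      \<comment> \<open>Now \<open>pt d\<close> is a convex combination of \<open>center F\<close>
        and \<open>pt c\<close> with both weights positive.\<close>
      assume neg: "\<not> a \<ge> 0"
      define L where "L = {l \<in> A. d l > 0}"
      obtain k e where k: "k \<in> L" and e: "e > 0"
        and near: "\<And>m. m \<in> A \<Longrightarrow> e * (center L \<bullet> w k - center L \<bullet> w m) \<le> pt d \<bullet> w k - pt d \<bullet> w m"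
        using nearest_vertex_in_support[OF d0 dsum L_def] by blast
      have LA: "L \<subseteq> A" and Lne: "L \<noteq> {}" using k by (auto simp: L_def)
      have "k \<in> F" using k dout[of k] by (auto simp: L_def)
      \<comment> \<open>A vertex \<open>m\<close> with weight in \<open>g F\<close> but none in
        \<open>d\<close> has \<open>c m = a * g F m < 0\<close>, so it lies in \<open>I\<close> and
        attains the maximum \<open>h'\<close>. The margin \<open>e > 0\<close> turns this into
        \<open>center L \<bullet> w k \<le> center L \<bullet> w m\<close>;
        \<open>center_inner_max\<close> gives the reverse.\<close>
      have const: "center L \<bullet> w m = center L \<bullet> center L" if m: "m \<in> A" "m \<in> L \<or> g F m \<noteq> 0" for m
      proof (cases "m \<in> L")
        case True
        then show ?thesis by (rule center_inner[OF LA])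
      next
        case False
        then have gm: "g F m > 0" "d m = 0" using m d0[OF m(1)] g0[of m] by (auto simp: L_def)
        then have "m \<in> F" using gout[of m] by force
        have "c m < 0" using cd[of m] gm neg by (simp add: mult_neg_pos)
        then have "m \<in> I" using cpos[of m] \<open>m \<in> F\<close> by force
        then have "pt d \<bullet> w k - pt d \<bullet> w m \<le> 0" using eqh' leh'[OF \<open>k \<in> F\<close>] by simp
        then have "e * (center L \<bullet> w k - center L \<bullet> w m) \<le> 0" using near[OF m(1)] by linarith
        then have "center L \<bullet> w k \<le> center L \<bullet> w m" using e by (simp add: mult_le_0_iff)
        then show ?thesis using center_inner_max[OF LA k m(1)] center_inner[OF LA k] by simp
      qed
      \<comment> \<open>Each center is now the foot of the perpendicular relative to the other, so
        they coincide. By uniqueness of coordinates this is absurd at \<open>k0\<close>, where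
        \<open>g F\<close> is positive and \<open>g L\<close> is zero.\<close>
      have "center L \<bullet> center F = sum (g F) A * (center L \<bullet> center L)"
        by (rule inner_pt_const) (use const in auto)
      moreover have "L \<subseteq> F" using dout by (fastforce simp: L_def)
      then have "center F \<bullet> center L = center F \<bullet> center F"
        using F Lne by (intro center_inner_center)
      ultimately have "(center L - center F) \<bullet> (center L - center F) = 0"
        using gsum by (simp add: inner_diff_left inner_diff_right inner_commute)
      then have "center F = center L" by simp
      then have "g F k0 = g L k0"
        using k0(1) F gsum sum_g[OF LA Lne] by (intro pt_inject[of "g F" "g L" k0]) auto
      moreover have "g L k0 = 0" using dk0 by (intro g_outside[OF LA Lne]) (auto simp: L_def)
      ultimately show False using k0 by simp
    qed
    then show ?thesis using cd[of i] d0[OF less.prems(9)] g0[of i] a1 by simp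
  qed
qed

end

section \<open>Coordinates and circumcenters of affinely independent sets\<close>

lemma convex_hull_image_coordinates:
  assumes "finite K" "inj_on v K"
  shows "x \<in> convex hull (v ` K) \<longleftrightarrow>
    (\<exists>c. (\<forall>i\<in>K. 0 \<le> c i) \<and> sum c K = 1 \<and> (\<Sum>i\<in>K. c i *\<^sub>R v i) = x)"
    (is "_ \<longleftrightarrow> ?R")
proof
  assume "x \<in> convex hull (v ` K)"
  then obtain u where "\<forall>y\<in>v ` K. 0 \<le> u y" "sum u (v ` K) = 1" "(\<Sum>y\<in>v ` K. u y *\<^sub>R y) = x"
    using assms(1) by (auto simp: convex_hull_finite)
  then show ?R using assms by (intro exI[of _ "u \<circ> v"]) (simp add: sum.reindex)
next
  assume ?R
  then obtain c where c: "\<forall>i\<in>K. 0 \<le> c i" "sum c K = 1" "(\<Sum>i\<in>K. c i *\<^sub>R v i) = x" by blast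
  have "(\<Sum>i\<in>K. c i *\<^sub>R v i) \<in> convex hull (v ` K)"
    using c(1,2) by (intro convex_sum[OF assms(1) convex_convex_hull]) (auto simp: hull_inc)
  then show "x \<in> convex hull (v ` K)" using c(3) by simp
qed

lemma affine_independent_image_coordinates:
  assumes "finite A" "inj_on v A" "\<not> affine_dependent (v ` A)"
    and "sum c A = 0" "(\<Sum>i\<in>A. c i *\<^sub>R v i) = 0" "i \<in> A"
  shows "c i = 0"
proof -
  let ?u = "c \<circ> inv_into A v"
  have "sum ?u (v ` A) = 0" "(\<Sum>y\<in>v ` A. ?u y *\<^sub>R y) = 0"
    using assms(2,4,5) by (simp_all add: sum.reindex)
  then have "?u (v i) = 0"
    using assms(1,3,6) by (auto simp: affine_dependent_explicit_finite)
  then show ?thesis using assms by simp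
qed

text \<open>Seen from a vertex \<open>a\<close>, a point \<open>a + y\<close> is equidistant iff
  \<open>b \<bullet> y = b \<bullet> b / 2\<close> for every edge vector \<open>b\<close>.
  Independence of the edges yields a linear functional with these values.\<close>

lemma equidistant_point_exists:
  fixes S :: "'a::euclidean_space set"
  assumes "\<not> affine_dependent S" "S \<noteq> {}"
  shows "\<exists>c\<in>affine hull S. \<exists>r. \<forall>w\<in>S. dist c w = r"
proof -
  obtain a where a: "a \<in> S" using assms(2) by auto
  define B where "B = (\<lambda>x. - a + x) ` (S - {a})"
  have "independent B"
    using assms(1) affine_dependent_iff_dependent[of a "S - {a}"] a by (simp add: B_def insert_absorb)
  from linear_independent_extend[OF this, of "\<lambda>b. b \<bullet> b / 2"] obtain f :: "'a \<Rightarrow> real"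
    where f: "linear f" "\<And>b. b \<in> B \<Longrightarrow> f b = b \<bullet> b / 2"
    by auto
  \<comment> \<open>The functional is the inner product with \<open>adjoint f 1\<close>; projecting
    that vector to \<open>span B\<close> keeps the values on \<open>B\<close> and puts
    \<open>a + y\<close> in the affine hull.\<close>
  obtain y z where yz: "y \<in> span B" "\<And>b. b \<in> span B \<Longrightarrow> orthogonal z b" "adjoint f 1 = y + z"
    by (rule orthogonal_subspace_decomp_exists[of B "adjoint f 1"]) blast
  have yb: "(y - b) \<bullet> (y - b) = y \<bullet> y" if "b \<in> B" for b
  proof -
    have "b \<bullet> z = 0" using yz(2)[OF span_base[OF that]] by (simp add: orthogonal_def inner_commute)
    moreover have "b \<bullet> (y + z) = f b" using adjoint_works[OF f(1), of b 1] yz(3) by simp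
    ultimately have "b \<bullet> y = b \<bullet> b / 2" using f(2)[OF that] by (simp add: inner_add_right)
    then show ?thesis by (simp add: inner_diff_left inner_diff_right inner_commute[of y b])
  qed
  have "dist (a + y) w = norm y" if w: "w \<in> S" for w
  proof (cases "w = a")
    case True
    then show ?thesis by (simp add: dist_norm)
  next
    case False
    then have "- a + w \<in> B" using w by (auto simp: B_def)
    from yb[OF this] have "norm (y - (- a + w)) = norm y" by (simp only: norm_eq)
    then show ?thesis by (simp add: dist_norm algebra_simps)
  qed
  moreover have "a + y \<in> affine hull S" using affine_hull_span2[OF a] yz(1) by (auto simp: B_def)
  ultimately show ?thesis by blast
qed

text \<open>Subtracting the squared distances shows that \<open>c - c'\<close> has constant inner
  product on the affine hull, hence is orthogonal to itself.\<close>

lemma equidistant_point_unique: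
  fixes S :: "'a::euclidean_space set"
  assumes "S \<noteq> {}" "c \<in> affine hull S" "c' \<in> affine hull S"
    and "\<And>w. w \<in> S \<Longrightarrow> dist c w = r" "\<And>w. w \<in> S \<Longrightarrow> dist c' w = r'"
  shows "c = c'"
proof -
  define k where "k = (c \<bullet> c - c' \<bullet> c' - r^2 + r'^2) / 2"
  have "(c - c') \<bullet> w = k" if "w \<in> S" for w
  proof -
    have "(c - w) \<bullet> (c - w) = r^2" "(c' - w) \<bullet> (c' - w) = r'^2"
      using assms(4,5)[OF that] by (simp_all add: dist_norm flip: power2_norm_eq_inner)
    then show ?thesis
      by (simp add: k_def inner_diff_left inner_diff_right inner_commute)
  qed
  then have "affine hull S \<subseteq> {x. (c - c') \<bullet> x = k}"
    by (intro hull_minimal) (auto simp: affine_hyperplane)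
  then have "(c - c') \<bullet> c = k" "(c - c') \<bullet> c' = k" using assms(2,3) by blast+
  then have "(c - c') \<bullet> (c - c') = 0" by (simp add: inner_diff_right)
  then show ?thesis by simp
qed

lemma circumcenter_equidistant:
  fixes S :: "'a::euclidean_space set"
  assumes "\<not> affine_dependent S" "S \<noteq> {}"
  obtains r where "\<And>w. w \<in> S \<Longrightarrow> dist (circumcenter (convex hull S)) w = r"
proof -
  let ?P = "\<lambda>c. c \<in> affine hull S \<and> (\<exists>r. \<forall>w\<in>S. dist c w = r)"
  have "\<exists>!c. ?P c"
  proof (rule ex_ex1I)
    show "\<exists>c. ?P c" using equidistant_point_exists[OF assms] by blast
    show "c = c'" if "?P c" "?P c'" for c c'
      using that equidistant_point_unique[OF assms(2)] by blast
  qed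
  then have "?P (THE c. ?P c)" by (rule theI')
  moreover have "circumcenter (convex hull S) = (THE c. ?P c)"
    unfolding circumcenter_def
    by (simp add: extreme_point_of_convex_hull_affine_independent[OF assms(1)] Ball_def)
  ultimately show thesis using that by auto
qed

section \<open>Circumcenter coordinates of a completely well-centered simplex\<close>

lemma nondegenerate_affine_independent:
  fixes v :: "nat \<Rightarrow> 'a::euclidean_space"
  assumes "nondegenerate (simplex_of v)"
  shows "\<not> affine_dependent (v ` index_set TYPE('a))" "inj_on v (index_set TYPE('a))"
proof -
  let ?A = "index_set TYPE('a)"
  have full: "aff_dim (v ` ?A) \<ge> int DIM('a)"
  proof (rule ccontr)
    assume "\<not> aff_dim (v ` ?A) \<ge> int DIM('a)"
    then have "aff_dim (v ` ?A) < int DIM('a)" by simp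
    then obtain a b where ab: "a \<noteq> 0" "v ` ?A \<subseteq> {x. a \<bullet> x = b}"
      by (rule aff_lowdim_subset_hyperplane)
    have "convex hull (v ` ?A) \<subseteq> {x. a \<bullet> x = b}"
      using ab(2) by (intro hull_minimal) (auto simp: convex_hyperplane)
    moreover have "affine {x. a \<bullet> x = b}" "aff_dim {x. a \<bullet> x = b} = int DIM('a) - 1"
      using ab(1) by (simp_all add: affine_hyperplane aff_dim_hyperplane)
    ultimately show False
      using assms unfolding nondegenerate_def simplex_of_def by blast
  qed
  have "aff_dim (v ` ?A) \<le> int (card (v ` ?A)) - 1" by (intro aff_dim_le_card) simp
  moreover have "card (v ` ?A) \<le> card ?A" by (intro card_image_le) simp
  ultimately have *: "card (v ` ?A) = card ?A" "aff_dim (v ` ?A) = int (card (v ` ?A)) - 1"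
    using full by auto
  show "inj_on v ?A" using *(1) by (intro eq_card_imp_inj_on) auto
  show "\<not> affine_dependent (v ` ?A)" using *(2) by (simp add: affine_independent_iff_card)
qed

lemma inner_eq_of_equidistant:
  fixes p c x y :: "'a::real_inner"
  assumes "dist p x = dist p y" "dist c x = dist c y"
  shows "(p - c) \<bullet> (x - c) = (p - c) \<bullet> (y - c)"
proof -
  have "(p - x) \<bullet> (p - x) = (p - y) \<bullet> (p - y)" "(c - x) \<bullet> (c - x) = (c - y) \<bullet> (c - y)"
    using assms by (simp_all add: dist_norm flip: norm_eq)
  then show ?thesis by (simp add: inner_diff_left inner_diff_right inner_commute)
qed

lemma completely_well_centered_coordinates:
  fixes v :: "nat \<Rightarrow> 'a::euclidean_space"
  assumes "nondegenerate (simplex_of v)" "completely_well_centered (simplex_of v)"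
  obtains g where
    "well_centered_points (index_set TYPE('a)) (\<lambda>i. v i - circumcenter (simplex_of v)) g"
proof -
  let ?A = "index_set TYPE('a)"
  let ?c = "circumcenter (simplex_of v)"
  note ind = nondegenerate_affine_independent[OF assms(1)]
  let ?cc = "\<lambda>K. circumcenter (convex hull (v ` K))"
  define P where "P K c \<longleftrightarrow> (\<forall>i. 0 \<le> c i) \<and> (\<forall>i. i \<notin> K \<longrightarrow> c i = 0) \<and> sum c ?A = 1 \<and>
      (\<Sum>i\<in>?A. c i *\<^sub>R v i) = ?cc K" for K and c :: "nat \<Rightarrow> real"
  have ex: "\<exists>c. P K c" if K: "K \<subseteq> ?A" "K \<noteq> {}" for K
  proof -
    \<comment> \<open>Hulls of vertex subsets are faces, so well-centeredness applies to each of
      them.\<close>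
    have "v ` K \<subseteq> v ` ?A" using K by (intro image_mono)
    then have "convex hull (v ` K) face_of simplex_of v"
      using face_of_convex_hull_affine_independent[OF ind(1)] unfolding simplex_of_def by blast
    moreover have "convex hull (v ` K) \<noteq> {}" using K by simp
    ultimately have "?cc K \<in> convex hull (v ` K)"
      using assms(2) by (auto simp: completely_well_centered_def)
    moreover have "finite K" "inj_on v K"
      using K finite_subset inj_on_subset[OF ind(2)] by auto
    ultimately obtain c where c: "\<forall>i\<in>K. 0 \<le> c i" "sum c K = 1" "(\<Sum>i\<in>K. c i *\<^sub>R v i) = ?cc K"
      by (auto simp: convex_hull_image_coordinates)
    let ?g = "\<lambda>i. if i \<in> K then c i else 0"
    have "sum ?g ?A = sum c K" by (rule sum.mono_neutral_cong_right) (use K in auto)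
    moreover have "(\<Sum>i\<in>?A. ?g i *\<^sub>R v i) = (\<Sum>i\<in>K. c i *\<^sub>R v i)"
      by (rule sum.mono_neutral_cong_right) (use K in auto)
    ultimately show ?thesis using c unfolding P_def by (intro exI[of _ ?g]) auto
  qed
  define g where "g K = (SOME c. P K c)" for K
  have "P K (g K)" if "K \<subseteq> ?A" "K \<noteq> {}" for K
    unfolding g_def using ex[OF that] by (rule someI_ex)
  then have g: "\<And>K i. K \<subseteq> ?A \<Longrightarrow> K \<noteq> {} \<Longrightarrow> 0 \<le> g K i"
    "\<And>K i. K \<subseteq> ?A \<Longrightarrow> K \<noteq> {} \<Longrightarrow> i \<notin> K \<Longrightarrow> g K i = 0"
    "\<And>K. K \<subseteq> ?A \<Longrightarrow> K \<noteq> {} \<Longrightarrow> sum (g K) ?A = 1"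
    "\<And>K. K \<subseteq> ?A \<Longrightarrow> K \<noteq> {} \<Longrightarrow> (\<Sum>i\<in>?A. g K i *\<^sub>R v i) = ?cc K"
    by (simp_all add: P_def)
  \<comment> \<open>Moving the origin to \<open>?c\<close> subtracts \<open>?c\<close> when the
    weights sum to 1 and changes nothing when they sum to 0.\<close>
  have shift: "(\<Sum>i\<in>?A. c i *\<^sub>R (v i - ?c)) = (\<Sum>i\<in>?A. c i *\<^sub>R v i) - sum c ?A *\<^sub>R ?c" for c
    by (simp add: scaleR_right_diff_distrib sum_subtractf scaleR_sum_left)
  have dist_eq: "dist (?cc K) (v i) = dist (?cc K) (v j)" if K: "K \<subseteq> ?A" "i \<in> K" "j \<in> K" for K i j
  proof -
    have "\<not> affine_dependent (v ` K)" "v ` K \<noteq> {}"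
      using ind(1) K affine_independent_subset[of "v ` ?A" "v ` K"] by auto
    then show ?thesis by (rule circumcenter_equidistant) (use K in auto)
  qed
  have "well_centered_points ?A (\<lambda>i. v i - ?c) g"
  proof
    show "c i = 0" if "sum c ?A = 0" "(\<Sum>i\<in>?A. c i *\<^sub>R (v i - ?c)) = 0" "i \<in> ?A" for c i
      using affine_independent_image_coordinates[OF _ ind(2,1) that(1) _ that(3)] that(1,2)
      unfolding shift by simp
    fix K i j assume K: "K \<subseteq> ?A" "i \<in> K" "j \<in> K"
    then have sum_eq: "(\<Sum>l\<in>?A. g K l *\<^sub>R (v l - ?c)) = ?cc K - ?c"
      unfolding shift using g(3,4)[of K] by fastforce
    have "dist ?c (v i) = dist ?c (v j)"
      unfolding simplex_of_def using K by (intro dist_eq) auto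
    then show "(\<Sum>l\<in>?A. g K l *\<^sub>R (v l - ?c)) \<bullet> (v i - ?c)
        = (\<Sum>l\<in>?A. g K l *\<^sub>R (v l - ?c)) \<bullet> (v j - ?c)"
      unfolding sum_eq by (intro inner_eq_of_equidistant dist_eq[OF K])
  qed (use g(1-3) in auto)
  then show thesis by (rule that)
qed

section \<open>The half simplex and its nearest-point map\<close>

lemma sum_half_vertex:
  fixes v :: "nat \<Rightarrow> 'a::euclidean_space"
  assumes "sum b A = 1"
  shows "(\<Sum>i\<in>A. b i *\<^sub>R half_vertex v i) =
    (1/2) *\<^sub>R (circumcenter (simplex_of v) + (\<Sum>i\<in>A. b i *\<^sub>R v i))"
proof -
  have "(\<Sum>i\<in>A. b i *\<^sub>R half_vertex v i) =
      (1/2) *\<^sub>R (sum b A *\<^sub>R circumcenter (simplex_of v) + (\<Sum>i\<in>A. b i *\<^sub>R v i))"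
    by (simp add: half_vertex_def scaleR_right_distrib sum.distrib scaleR_sum_left scaleR_sum_right
        mult.commute)
  then show ?thesis using assms by simp
qed

lemma barycentric_half_vertex:
  fixes v :: "nat \<Rightarrow> 'a::euclidean_space"
  assumes "nondegenerate (simplex_of v)"
    and "\<And>i. i \<notin> index_set TYPE('a) \<Longrightarrow> b i = 0" "sum b (index_set TYPE('a)) = 1"
    and "(\<Sum>i\<in>index_set TYPE('a). b i *\<^sub>R half_vertex v i) = x"
  shows "barycentric (half_vertex v) x = b"
  unfolding barycentric_def
proof (rule the_equality)
  let ?A = "index_set TYPE('a)"
  fix d assume d: "(\<forall>i. i \<notin> ?A \<longrightarrow> d i = 0) \<and> sum d ?A = 1 \<and> (\<Sum>i\<in>?A. d i *\<^sub>R half_vertex v i) = x"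
  then have "(\<Sum>i\<in>?A. d i *\<^sub>R v i) = (\<Sum>i\<in>?A. b i *\<^sub>R v i)"
    using assms(3,4) sum_half_vertex[of d ?A v] sum_half_vertex[of b ?A v] by simp
  then have "d i - b i = 0" if "i \<in> ?A" for i
    using affine_independent_image_coordinates[of ?A v "\<lambda>i. d i - b i" i]
      nondegenerate_affine_independent[OF assms(1)] d assms(3) that
    by (simp add: sum_subtractf scaleR_left_diff_distrib)
  then show "d = b" using d assms(2) by (metis eq_iff_diff_eq_0 ext)
qed (use assms(2-4) in auto)

text \<open>The homothety from the simplex to its half preserves barycentric coordinates, so those
  of \<open>p\<close> are the hull coordinates of its preimage.\<close>

lemma open_face_coordinates:
  fixes v :: "nat \<Rightarrow> 'a::euclidean_space"
  assumes nd: "nondegenerate (simplex_of v)" and p: "p \<in> open_face v I"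
  obtains b where "\<And>i. i \<in> index_set TYPE('a) \<Longrightarrow> 0 \<le> b i" "sum b (index_set TYPE('a)) = 1"
    "p = (1/2) *\<^sub>R (circumcenter (simplex_of v) + (\<Sum>i\<in>index_set TYPE('a). b i *\<^sub>R v i))"
    "\<And>i. i \<in> I \<Longrightarrow> b i > 0" "\<And>i. i \<in> index_set TYPE('a) - I \<Longrightarrow> b i = 0"
proof -
  let ?A = "index_set TYPE('a)"
  obtain y where y: "y \<in> simplex_of v" "p = (1/2) *\<^sub>R (circumcenter (simplex_of v) + y)"
    using p by (auto simp: open_face_def half_simplex_def)
  then obtain c where c: "\<forall>i\<in>?A. 0 \<le> c i" "sum c ?A = 1" "(\<Sum>i\<in>?A. c i *\<^sub>R v i) = y"
    unfolding simplex_of_def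
    using convex_hull_image_coordinates[OF _ nondegenerate_affine_independent(2)[OF nd]] by auto
  define b where "b i = (if i \<in> ?A then c i else 0)" for i
  have b: "sum b ?A = 1" "(\<Sum>i\<in>?A. b i *\<^sub>R v i) = y" using c by (simp_all add: b_def)
  have "barycentric (half_vertex v) p = b"
    using b y sum_half_vertex[OF b(1), of v]
    by (intro barycentric_half_vertex[OF nd]) (auto simp: b_def)
  then have face: "\<forall>i\<in>I. b i > 0" "\<forall>i\<in>?A - I. b i = 0" using p by (auto simp: open_face_def)
  show thesis
  proof (rule that[of b])
    show "0 \<le> b i" if "i \<in> ?A" for i using c(1) that by (simp add: b_def)
    show "p = (1/2) *\<^sub>R (circumcenter (simplex_of v) + (\<Sum>i\<in>?A. b i *\<^sub>R v i))"
      unfolding b(2) by (rule y(2))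
  qed (use face b(1) in auto)
qed

lemma closest_point_half_simplex:
  fixes v :: "nat \<Rightarrow> 'a::euclidean_space"
  assumes "k \<in> index_set TYPE('a)"
  shows "(x - closest_point (half_simplex v) x) \<bullet>
    (half_vertex v k - closest_point (half_simplex v) x) \<le> 0"
proof (rule closest_point_dot)
  have eq: "half_simplex v = (\<lambda>y. (1/2) *\<^sub>R circumcenter (simplex_of v) + (1/2) *\<^sub>R y) ` simplex_of v"
    by (simp add: half_simplex_def scaleR_right_distrib)
  show "convex (half_simplex v)" unfolding eq
    by (intro convex_affinity) (simp add: simplex_of_def convex_convex_hull)
  have "compact (half_simplex v)" unfolding eq
    by (intro compact_affinity) (simp add: simplex_of_def finite_imp_compact_convex_hull)
  then show "closed (half_simplex v)" by (rule compact_imp_closed)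
  show "half_vertex v k \<in> half_simplex v"
    using assms by (auto simp: half_simplex_def half_vertex_def simplex_of_def intro!: hull_inc)
qed

section \<open>Admissibility of the simplex\<close>

theorem proposition3p4:
  fixes v :: "nat \<Rightarrow> 'a::euclidean_space"
  assumes "nondegenerate (simplex_of v)"
    and "completely_well_centered (simplex_of v)"
  shows "admissible_domain v (simplex_of v)"
proof -
  let ?A = "index_set TYPE('a)"
  let ?c = "circumcenter (simplex_of v)"
  obtain g where g: "well_centered_points ?A (\<lambda>i. v i - ?c) g"
    using completely_well_centered_coordinates[OF assms] .
  interpret well_centered_points ?A "\<lambda>i. v i - ?c" g by (rule g)
  have coords: "x \<in> simplex_of v \<longleftrightarrow>
      (\<exists>c. (\<forall>i\<in>?A. 0 \<le> c i) \<and> sum c ?A = 1 \<and> (\<Sum>i\<in>?A. c i *\<^sub>R v i) = x)" for x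
    unfolding simplex_of_def
    using nondegenerate_affine_independent(2)[OF assms(1)]
    by (intro convex_hull_image_coordinates) auto
  have "x - closest_point (half_simplex v) x + half_vertex v i \<in> simplex_of v"
    if x: "x \<in> simplex_of v" and I: "I \<subseteq> ?A" and i: "i \<in> I"
      and face: "closest_point (half_simplex v) x \<in> open_face v I" for x I i
  proof -
    define p where "p = closest_point (half_simplex v) x"
    obtain l where l: "\<And>k. k \<in> ?A \<Longrightarrow> 0 \<le> l k" "sum l ?A = 1" "(\<Sum>k\<in>?A. l k *\<^sub>R v k) = x"
      using x coords by blast
    obtain b where b: "\<And>k. k \<in> ?A \<Longrightarrow> 0 \<le> b k" "sum b ?A = 1"
      "p = (1/2) *\<^sub>R (?c + (\<Sum>k\<in>?A. b k *\<^sub>R v k))"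
      "\<And>k. k \<in> I \<Longrightarrow> b k > 0" "\<And>k. k \<in> ?A - I \<Longrightarrow> b k = 0"
      by (rule open_face_coordinates[OF assms(1) face[folded p_def]]) blast
    define m where "m k = 2 * l k - b k" for k
    \<comment> \<open>As \<open>v k - ?c = 2 (u_k - p) + 2 (p - ?c)\<close>, with \<open>u_k\<close>
      the half vertex, this is the part of \<open>pt m \<bullet> (v k - ?c)\<close> independent of
      \<open>k\<close>; the other part is nonpositive by the nearest-point inequality.\<close>
    define h where "h = (x - p) \<bullet> (4 *\<^sub>R (p - ?c))"
    have msum: "sum m ?A = 1"
      using l(2) b(2) by (simp add: m_def sum_subtractf flip: sum_distrib_left)
    have "pt m = 2 *\<^sub>R (\<Sum>k\<in>?A. l k *\<^sub>R v k) - (\<Sum>k\<in>?A. b k *\<^sub>R v k) - sum m ?A *\<^sub>R ?c"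
      by (simp add: pt_def m_def scaleR_right_diff_distrib scaleR_left_diff_distrib sum_subtractf
          scaleR_sum_left scaleR_sum_right)
    then have ptm: "pt m = 2 *\<^sub>R (x - p)" using msum l(3) b(3) by (simp add: algebra_simps)
    have "pt b = (\<Sum>k\<in>?A. b k *\<^sub>R v k) - sum b ?A *\<^sub>R ?c"
      by (simp add: pt_def scaleR_right_diff_distrib sum_subtractf scaleR_sum_left)
    then have ptb: "pt b = 2 *\<^sub>R (p - ?c)" unfolding b(2,3) by (simp add: algebra_simps scaleR_2)
    have leh: "pt m \<bullet> (v k - ?c) \<le> h" if "k \<in> ?A" for k
    proof -
      have "v k - ?c = 2 *\<^sub>R (half_vertex v k - p) + 2 *\<^sub>R (p - ?c)"
        by (simp add: half_vertex_def algebra_simps flip: scaleR_2)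
      then have "pt m \<bullet> (v k - ?c) = 4 * ((x - p) \<bullet> (half_vertex v k - p)) + h"
        unfolding ptm h_def by (simp only: inner_add_right inner_scaleR_left inner_scaleR_right)
      then show ?thesis using closest_point_half_simplex[OF that, of x v] by (simp add: p_def)
    qed
    \<comment> \<open>Complementary slackness: the slacks, weighted by \<open>b\<close>, are
      nonnegative with sum 0, so they vanish wherever \<open>b\<close> is positive.\<close>
    have "(\<Sum>k\<in>?A. b k * (h - pt m \<bullet> (v k - ?c))) = sum b ?A * h - pt m \<bullet> pt b"
      by (simp add: inner_pt right_diff_distrib sum_subtractf flip: sum_distrib_right)
    also have "\<dots> = 0" unfolding ptb ptm h_def b(2) by simp
    finally have "\<forall>k\<in>?A. b k * (h - pt m \<bullet> (v k - ?c)) = 0"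
      using b(1) leh by (subst (asm) sum_nonneg_eq_0_iff) auto
    then have eqh: "pt m \<bullet> (v k - ?c) = h" if "k \<in> I" for k using b(4)[OF that] I that by force
    have m0: "0 \<le> m k" if "k \<in> ?A" for k
      by (rule normal_cone_coordinates_nonneg[of ?A I m h k])
        (use I i msum leh eqh l(1) b(5) that in \<open>auto simp: m_def\<close>)
    \<comment> \<open>The target is the midpoint of \<open>v i\<close> and the point
      \<open>?c + 2 (x - p)\<close>, whose coordinates are \<open>m\<close>.\<close>
    define d where "d k = (m k + (if k = i then 1 else 0)) / 2" for k
    have iA: "i \<in> ?A" using I i by auto
    have "sum d ?A = 1"
      using msum iA by (simp add: d_def sum.distrib flip: sum_divide_distrib)
    moreover have "d k \<ge> 0" if "k \<in> ?A" for k using m0[OF that] by (simp add: d_def)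
    moreover have "(\<Sum>k\<in>?A. d k *\<^sub>R v k) = x - p + half_vertex v i"
    proof -
      have "(\<Sum>k\<in>?A. d k *\<^sub>R v k) =
          (\<Sum>k\<in>?A. l k *\<^sub>R v k - (1/2) *\<^sub>R (b k *\<^sub>R v k) + (if k = i then (1/2) *\<^sub>R v i else 0))"
        by (intro sum.cong refl) (simp add: d_def m_def algebra_simps add_divide_distrib diff_divide_distrib)
      also have "\<dots> = x - (1/2) *\<^sub>R (\<Sum>k\<in>?A. b k *\<^sub>R v k) + (1/2) *\<^sub>R v i"
        using l(3) iA by (simp add: sum.distrib sum_subtractf scaleR_sum_right)
      also have "\<dots> = x - p + half_vertex v i"
        unfolding b(3) by (simp add: half_vertex_def algebra_simps flip: scaleR_2)
      finally show ?thesis .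
    qed
    ultimately show ?thesis unfolding coords p_def by blast
  qed
  then show ?thesis
    by (auto simp: admissible_domain_def simplex_of_def convex_convex_hull)
qed

end
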